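(* Let $F_1, F_2\colon \mathbb{R}^n\rightrightarrows \mathbb{R}^p$ be nearly convex set-valued mappings such that $$\mathrm{ri}(\mathrm{dom}\, F_1)\cap \mathrm{ri}(\mathrm{dom}\, F_2)\neq\emptyset.$$ Then the set-valued mapping $F_1+F_2$ is also nearly convex.
   Context: A set $\Omega\subset\mathbb{R}^k$ is nearly convex if there exists a convex set $C\subset\mathbb{R}^k$ such that $C\subset\Omega\subset\overline{C}$, where $\overline{C}$ is the closure of $C$. For an arbitrary set $\Omega\subset\mathbb{R}^k$, the relative interior is $\mathrm{ri}\,\Omega=\{a\in\Omega \mid \text{there exists } \delta>0 \text{ with } B(a;\delta)\cap \mathrm{aff}\,\Omega\subset\Omega\}$, where $\mathrm{aff}\,\Omega$ is the affine hull and $B(a;\delta)$ the open ball. A set-valued mapping $F\colon\mathbb{R}^n\rightrightarrows\mathbb{R}^p$ assigns to each $x\in\mathbb{R}^n$ a (possibly empty) subset $F(x)\subset\mathbb{R}^p$; $\mathrm{dom}\,F=\{x\mid F(x)\neq\emptyset\}$ and $\mathrm{gph}\,F=\{(x,y)\in\mathbb{R}^n\times\mathbb{R}^p\mid y\in F(x)\}$. $F$ is nearly convex if $\mathrm{gph}\,F$ is a nearly convex set. The sum is $(F_1+F_2)(x)=\{y_1+y_2\mid y_1\in F_1(x),\ y_2\in F_2(x)\}$. *)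

theory Defs
  imports "HOL-Analysis.Analysis"
begin

text \<open>
  The relative interior of an arbitrary set is the library constant \<open>rel_interior\<close>; its
  characterization by balls and the affine hull is the library lemma \<open>mem_rel_interior_ball\<close>.
\<close>

definition nearly_convex :: "'a::euclidean_space set \<Rightarrow> bool"
  where "nearly_convex \<Omega> \<longleftrightarrow> (\<exists>C. convex C \<and> C \<subseteq> \<Omega> \<and> \<Omega> \<subseteq> closure C)"

text \<open>
  A set-valued mapping is a function into sets; the value may be empty.
\<close>

definition svm_dom :: "('a \<Rightarrow> 'b set) \<Rightarrow> 'a set"
  where "svm_dom F = {x. F x \<noteq> {}}"

definition svm_graph :: "('a \<Rightarrow> 'b set) \<Rightarrow> ('a \<times> 'b) set"
  where "svm_graph F = {(x, y). y \<in> F x}"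

definition svm_nearly_convex :: "('a::euclidean_space \<Rightarrow> 'b::euclidean_space set) \<Rightarrow> bool"
  where "svm_nearly_convex F \<longleftrightarrow> nearly_convex (svm_graph F)"

definition svm_sum :: "('a \<Rightarrow> 'b::plus set) \<Rightarrow> ('a \<Rightarrow> 'b set) \<Rightarrow> 'a \<Rightarrow> 'b set"
  where "svm_sum F\<^sub>1 F\<^sub>2 x = {y\<^sub>1 + y\<^sub>2 | y\<^sub>1 y\<^sub>2. y\<^sub>1 \<in> F\<^sub>1 x \<and> y\<^sub>2 \<in> F\<^sub>2 x}"

end

theory Submission
  imports Defs
begin

text \<open>
  Let \<open>C\<^sub>i\<close> be convex with \<open>C\<^sub>i \<subseteq> gph F\<^sub>i \<subseteq> closure C\<^sub>i\<close>, and let \<open>x\<^sub>0\<close> be a common relative interior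
  point of the domains. Relative interiors commute with the projection, so there are points
  \<open>(x\<^sub>0, u\<^sub>i)\<close> in the relative interiors of the \<open>C\<^sub>i\<close>. Moving \<open>(x, y\<^sub>1)\<close> and \<open>(x, y\<^sub>2)\<close> slightly towards
  \<open>(x\<^sub>0, u\<^sub>1)\<close> and \<open>(x\<^sub>0, u\<^sub>2)\<close> by the same factor puts them into \<open>C\<^sub>1\<close> and \<open>C\<^sub>2\<close> while the first
  coordinates stay equal, so \<open>(x, y\<^sub>1 + y\<^sub>2)\<close> is a limit of points of the fibrewise sum of \<open>C\<^sub>1\<close> and \<open>C\<^sub>2\<close>.
\<close>

text \<open>\<open>C\<close>, \<open>S\<close> and \<open>closure C\<close> share one affine hull,
  so their relative interiors are nested; convexity makes the outer two equal.\<close>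

lemma rel_interior_between_closure:
  fixes C S :: "'a::euclidean_space set"
  assumes "convex C" "C \<subseteq> S" "S \<subseteq> closure C"
  shows "rel_interior S = rel_interior C"
proof -
  have "closure S = closure C"
    using assms by (metis closure_closure closure_mono subset_antisym)
  then have "affine hull S = affine hull C"
    by (metis closure_same_affine_hull)
  then have "rel_interior C \<subseteq> rel_interior S" "rel_interior S \<subseteq> rel_interior (closure C)"
    using assms by (simp_all add: subset_rel_interior)
  then show ?thesis
    using convex_rel_interior_closure[OF \<open>convex C\<close>] by simp
qed

lemma fst_image_svm_graph: "fst ` svm_graph F = svm_dom F"
  by (force simp: svm_graph_def svm_dom_def)

lemma rel_interior_svm_dom:
  fixes F :: "'a::euclidean_space \<Rightarrow> 'b::euclidean_space set"
  assumes "convex C" "C \<subseteq> svm_graph F" "svm_graph F \<subseteq> closure C"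
  shows "rel_interior (svm_dom F) = fst ` rel_interior C"
proof -
  have "fst ` closure C \<subseteq> closure (fst ` C)"
    by (rule closure_linear_image_subset[OF linear_fst])
  then have "svm_dom F \<subseteq> closure (fst ` C)"
    using assms(3) unfolding fst_image_svm_graph[symmetric] by blast
  moreover have "fst ` C \<subseteq> svm_dom F"
    using assms(2) unfolding fst_image_svm_graph[symmetric] by blast
  ultimately have "rel_interior (svm_dom F) = rel_interior (fst ` C)"
    by (intro rel_interior_between_closure convex_linear_image linear_fst \<open>convex C\<close>)
  also have "\<dots> = fst ` rel_interior C"
    by (rule rel_interior_convex_linear_image[OF linear_fst \<open>convex C\<close>, symmetric])
  finally show ?thesis .
qed

text \<open>Applying the same weights in both sets keeps the first coordinates equal.\<close>

lemma convex_fibrewise_sum: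
  fixes C\<^sub>1 C\<^sub>2 :: "('a::real_vector \<times> 'b::real_vector) set"
  assumes "convex C\<^sub>1" "convex C\<^sub>2"
  shows "convex {(x, y\<^sub>1 + y\<^sub>2) | x y\<^sub>1 y\<^sub>2. (x, y\<^sub>1) \<in> C\<^sub>1 \<and> (x, y\<^sub>2) \<in> C\<^sub>2}" (is "convex ?C")
proof (rule convexI)
  fix p q and u v :: real
  assume "p \<in> ?C" "q \<in> ?C" and uv: "0 \<le> u" "0 \<le> v" "u + v = 1"
  then obtain x y\<^sub>1 y\<^sub>2 x' y\<^sub>1' y\<^sub>2' where
    p: "p = (x, y\<^sub>1 + y\<^sub>2)" "(x, y\<^sub>1) \<in> C\<^sub>1" "(x, y\<^sub>2) \<in> C\<^sub>2" and
    q: "q = (x', y\<^sub>1' + y\<^sub>2')" "(x', y\<^sub>1') \<in> C\<^sub>1" "(x', y\<^sub>2') \<in> C\<^sub>2"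
    by blast
  have "(u *\<^sub>R x + v *\<^sub>R x', u *\<^sub>R y\<^sub>1 + v *\<^sub>R y\<^sub>1') \<in> C\<^sub>1"
    using convexD[OF assms(1) p(2) q(2) uv] by simp
  moreover have "(u *\<^sub>R x + v *\<^sub>R x', u *\<^sub>R y\<^sub>2 + v *\<^sub>R y\<^sub>2') \<in> C\<^sub>2"
    using convexD[OF assms(2) p(3) q(3) uv] by simp
  moreover have "u *\<^sub>R p + v *\<^sub>R q =
      (u *\<^sub>R x + v *\<^sub>R x', (u *\<^sub>R y\<^sub>1 + v *\<^sub>R y\<^sub>1') + (u *\<^sub>R y\<^sub>2 + v *\<^sub>R y\<^sub>2'))"
    by (simp add: p(1) q(1) scaleR_add_right)
  ultimately show "u *\<^sub>R p + v *\<^sub>R q \<in> ?C"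
    by blast
qed

lemma in_closure_if_shrink:
  fixes a b :: "'a::real_normed_vector"
  assumes "\<And>t. 0 < t \<Longrightarrow> t \<le> 1 \<Longrightarrow> a - t *\<^sub>R (a - b) \<in> S"
  shows "a \<in> closure S"
proof (rule Lim_in_closed_set[OF closed_closure])
  \<comment> \<open>Only these \<open>t\<close> are covered by the assumption, hence the one-sided
    limit.\<close>
  have "\<forall>\<^sub>F t in at_right 0. (0::real) < t \<and> t < 1"
    by (intro eventually_conj eventually_at_right_less eventually_at_right_field[THEN iffD2])
       (auto intro: exI[of _ 1])
  then show "\<forall>\<^sub>F t in at_right 0. a - t *\<^sub>R (a - b) \<in> closure S"
    by eventually_elim (use assms closure_subset in force)
  show "((\<lambda>t. a - t *\<^sub>R (a - b)) \<longlongrightarrow> a) (at_right 0)"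
    by (auto intro!: tendsto_eq_intros)
qed simp

theorem theorem4p2:
  fixes F\<^sub>1 F\<^sub>2 :: "real ^ 'n \<Rightarrow> (real ^ 'p) set"
  assumes "svm_nearly_convex F\<^sub>1" and "svm_nearly_convex F\<^sub>2"
    and "rel_interior (svm_dom F\<^sub>1) \<inter> rel_interior (svm_dom F\<^sub>2) \<noteq> {}"
  shows "svm_nearly_convex (svm_sum F\<^sub>1 F\<^sub>2)"
proof -
  obtain C\<^sub>1 where C\<^sub>1: "convex C\<^sub>1" "C\<^sub>1 \<subseteq> svm_graph F\<^sub>1" "svm_graph F\<^sub>1 \<subseteq> closure C\<^sub>1"
    using assms(1) unfolding svm_nearly_convex_def nearly_convex_def by blast
  obtain C\<^sub>2 where C\<^sub>2: "convex C\<^sub>2" "C\<^sub>2 \<subseteq> svm_graph F\<^sub>2" "svm_graph F\<^sub>2 \<subseteq> closure C\<^sub>2"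
    using assms(2) unfolding svm_nearly_convex_def nearly_convex_def by blast
  obtain x\<^sub>0 u\<^sub>1 u\<^sub>2 where u\<^sub>1: "(x\<^sub>0, u\<^sub>1) \<in> rel_interior C\<^sub>1" and u\<^sub>2: "(x\<^sub>0, u\<^sub>2) \<in> rel_interior C\<^sub>2"
    using assms(3) rel_interior_svm_dom[OF C\<^sub>1] rel_interior_svm_dom[OF C\<^sub>2] by force
  define C where "C = {(x, y\<^sub>1 + y\<^sub>2) | x y\<^sub>1 y\<^sub>2. (x, y\<^sub>1) \<in> C\<^sub>1 \<and> (x, y\<^sub>2) \<in> C\<^sub>2}"
  have "convex C"
    unfolding C_def by (rule convex_fibrewise_sum[OF C\<^sub>1(1) C\<^sub>2(1)])
  moreover have "C \<subseteq> svm_graph (svm_sum F\<^sub>1 F\<^sub>2)"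
    using C\<^sub>1(2) C\<^sub>2(2) unfolding C_def svm_graph_def svm_sum_def by blast
  moreover have "svm_graph (svm_sum F\<^sub>1 F\<^sub>2) \<subseteq> closure C"
  proof
    fix p assume "p \<in> svm_graph (svm_sum F\<^sub>1 F\<^sub>2)"
    then obtain x y\<^sub>1 y\<^sub>2 where p: "p = (x, y\<^sub>1 + y\<^sub>2)"
      and y: "(x, y\<^sub>1) \<in> closure C\<^sub>1" "(x, y\<^sub>2) \<in> closure C\<^sub>2"
      using C\<^sub>1(3) C\<^sub>2(3) unfolding svm_graph_def svm_sum_def by blast
    show "p \<in> closure C"
    \<comment> \<open>The target point \<open>b\<close> stays schematic here; the final
      \<open>show\<close> fixes it as \<open>(x\<^sub>0, u\<^sub>1 + u\<^sub>2)\<close>.\<close>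
    proof (rule in_closure_if_shrink)
      fix t :: real assume t: "0 < t" "t \<le> 1"
      have "(x - t *\<^sub>R (x - x\<^sub>0), y\<^sub>1 - t *\<^sub>R (y\<^sub>1 - u\<^sub>1)) \<in> C\<^sub>1"
        using subsetD[OF rel_interior_subset
            rel_interior_closure_convex_shrink[OF C\<^sub>1(1) u\<^sub>1 y(1) t]] by simp
      moreover have "(x - t *\<^sub>R (x - x\<^sub>0), y\<^sub>2 - t *\<^sub>R (y\<^sub>2 - u\<^sub>2)) \<in> C\<^sub>2"
        using subsetD[OF rel_interior_subset
            rel_interior_closure_convex_shrink[OF C\<^sub>2(1) u\<^sub>2 y(2) t]] by simp
      \<comment> \<open>Shrinking is affine with a common \<open>t\<close>, so the shrunk summands
        add up to the shrunk sum over the same base point.\<close>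
      moreover have "p - t *\<^sub>R (p - (x\<^sub>0, u\<^sub>1 + u\<^sub>2)) =
          (x - t *\<^sub>R (x - x\<^sub>0), (y\<^sub>1 - t *\<^sub>R (y\<^sub>1 - u\<^sub>1)) + (y\<^sub>2 - t *\<^sub>R (y\<^sub>2 - u\<^sub>2)))"
        by (simp add: p algebra_simps)
      ultimately show "p - t *\<^sub>R (p - (x\<^sub>0, u\<^sub>1 + u\<^sub>2)) \<in> C"
        unfolding C_def by blast
    qed
  qed
  ultimately show ?thesis
    unfolding svm_nearly_convex_def nearly_convex_def by blast
qed

end
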